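(* Let $S=\{2,3,5,15,20,29,39,50,51,68\}$, let $t>1$ be an integer and let $n\ge 0$ be an integer. Then $E_n(1,x)$ is a permutation polynomial over $\mathbb{Z}_{3^t}$ if and only if $n$ is congruent modulo $72$ to an element of $S$.
   Context: The $n$th reversed Dickson polynomial of the second kind (with parameter $1$) is the integer-coefficient polynomial $E_n(1,x)=\sum_{i=0}^{\lfloor n/2\rfloor}\binom{n-i}{i}(-x)^i$; equivalently $E_0(1,x)=1$, $E_1(1,x)=1$, $E_n(1,x)=E_{n-1}(1,x)-x\,E_{n-2}(1,x)$ for $n\ge 2$. $\mathbb{Z}_m$ is the ring of integers modulo $m$; an integer polynomial is a permutation polynomial over $\mathbb{Z}_m$ if the map it induces $\mathbb{Z}_m\to\mathbb{Z}_m$ is a bijection. *)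

theory Defs
  imports "HOL-Computational_Algebra.Polynomial" "HOL-Number_Theory.Residues"
begin

text \<open>The $n$th reversed Dickson polynomial of the second kind with parameter $1$, $E_n(1,x)$.\<close>

definition rev_dickson2 :: "nat \<Rightarrow> int poly" where
  "rev_dickson2 n = (\<Sum>i\<le>n div 2. of_nat ((n - i) choose i) * (- [:0, 1:]) ^ i)"

text \<open>The ring of integers modulo \<open>m\<close> is represented by least nonnegative residues
  (\<open>residue_ring\<close>), so the map induced by \<open>p\<close> is evaluation over the integers followed by
  reduction.\<close>

definition permutation_poly_mod :: "int \<Rightarrow> int poly \<Rightarrow> bool" where
  "permutation_poly_mod m p \<longleftrightarrow>
     bij_betw (\<lambda>a. poly p a mod m) (carrier (residue_ring m)) (carrier (residue_ring m))"

end

theory Submission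
  imports Defs
begin

text \<open>
  Write $E_n$ for the $n$-th polynomial. For a prime $p$ and $t > 1$, an integer polynomial $f$
  permutes the residues modulo $p^t$ if and only if it permutes those modulo $p$ and $f'$ has no
  zero modulo $p$ (\<open>permutation_poly_mod_prime_power_iff\<close>). This comes from the expansion
  $f(a + h) = f(a) + h f'(a) + h^2 q$: with $h$ an exact multiple of $p^k$ and $k \geq 1$, the quadratic term
  vanishes modulo $p^{k+1}$, so $f'(a)$ alone decides whether the difference of the values is still
  an exact multiple of $p^k$. The condition does not depend on $t$ any more.

  For $p = 3$ it remains to know $E_n(a)$ and $E_n'(a)$ modulo $3$ at $a = 0, 1, 2$. The
  recurrence $E_{n+2} = E_{n+1} - x E_n$ and its derivative determine the residues of
  $(E_{n+1}, E_{n+2}, E_{n+1}', E_{n+2}')$ at $a$ from those of $(E_n, E_{n+1}, E_n', E_{n+1}')$,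
  so these quadruples are the orbit of a map on a finite set. The characteristic polynomial
  $z^2 - z + a$ of the recurrence for the values is $z(z - 1)$ for $a = 0$, $(z + 1)^2$ for
  $a = 1$, and irreducible over the field with three elements with roots of order $8$ for $a = 2$.
  The derivatives obey its square, which makes the three orbits eventually periodic with periods
  dividing $3$, $18$ and $24$; hence the modulus $72 = \mathrm{lcm}(3, 18, 24)$. Running through
  one period yields the ten residue classes (\<open>permuting_table\<close>).

  At $a = 0$ the step is not invertible, because there $E_{n+2} = E_{n+1}$ forgets $E_n$. The
  orbit is therefore only eventually periodic: $E_0' = 0$, whereas $E_{72}'(0) = -71$, which is
  $1$ modulo $3$. The period starts at $n = 1$, and the constant polynomial $E_0$ is handled
  separately.
\<close>

section \<open>Permutation polynomials modulo prime powers\<close>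

lemma poly_add_second_order:
  fixes f :: "'a :: {comm_ring_1, ring_no_zero_divisors} poly"
  shows "\<exists>q. poly f (a + h) = poly f a + h * poly (pderiv f) a + h\<^sup>2 * q"
proof (induction f)
  case 0
  show ?case by (intro exI[of _ 0]) simp
next
  case (pCons c g)
  from pCons.IH obtain q
    where q: "poly g (a + h) = poly g a + h * poly (pderiv g) a + h\<^sup>2 * q" by blast
  show ?case
    by (intro exI[of _ "poly (pderiv g) a + (a + h) * q"])
       (simp add: q pderiv_pCons algebra_simps power2_eq_square)
qed

lemma cong_poly:
  fixes f :: "int poly"
  assumes "[a = b] (mod m)"
  shows "[poly f a = poly f b] (mod m)"
  using assms by (induction f) (auto intro!: cong_add cong_mult)

lemma permutation_poly_mod_iff_inj:
  fixes m :: int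
  assumes "m > 0"
  shows "permutation_poly_mod m f \<longleftrightarrow>
    (\<forall>a b. [poly f a = poly f b] (mod m) \<longrightarrow> [a = b] (mod m))"
proof -
  let ?R = "{0..m - 1}" and ?g = "\<lambda>a. poly f a mod m"
  have "?g ` ?R \<subseteq> ?R" using assms by (auto simp: zle_diff1_eq)
  then have "permutation_poly_mod m f \<longleftrightarrow> inj_on ?g ?R"
    using endo_inj_surj[of ?R ?g]
    by (auto simp: permutation_poly_mod_def residue_ring_def bij_betw_def)
  also have "\<dots> \<longleftrightarrow> (\<forall>a b. [poly f a = poly f b] (mod m) \<longrightarrow> [a = b] (mod m))"
  proof (intro iffI allI impI)
    fix a b
    assume inj: "inj_on ?g ?R" and ab: "[poly f a = poly f b] (mod m)"
    have "?g (x mod m) = ?g x" for x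
      using cong_poly[of "x mod m" x m f] by (simp add: cong_def)
    then have "?g (a mod m) = ?g (b mod m)"
      using ab by (simp add: cong_def)
    from inj_onD[OF inj this] have "a mod m = b mod m"
      using assms by (simp add: zle_diff1_eq)
    then show "[a = b] (mod m)" by (simp add: cong_def)
  next
    assume *: "\<forall>a b. [poly f a = poly f b] (mod m) \<longrightarrow> [a = b] (mod m)"
    show "inj_on ?g ?R"
    proof (rule inj_onI)
      fix a b assume R: "a \<in> ?R" "b \<in> ?R" and "?g a = ?g b"
      then have "[a = b] (mod m)"
        using * unfolding cong_def by blast
      then show "a = b"
        using R by (simp add: cong_def)
    qed
  qed
  finally show ?thesis .
qed

text \<open>
  Surjectivity is what descends to a divisor of the modulus: a preimage modulo \<open>m\<close> is also one
  modulo \<open>d\<close>. Injectivity then follows by counting.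
\<close>
lemma permutation_poly_mod_dvd:
  fixes m d :: int
  assumes "permutation_poly_mod m f" "d dvd m" "m > 0" "d > 0"
  shows "permutation_poly_mod d f"
proof -
  let ?R = "{0..d - 1}" and ?g = "\<lambda>a. poly f a mod d"
  have sub: "?g ` ?R \<subseteq> ?R" using assms by (auto simp: zle_diff1_eq)
  have "d \<le> m" using assms by (simp add: zdvd_imp_le)
  have "?R \<subseteq> ?g ` ?R"
  proof
    fix c assume c: "c \<in> ?R"
    then have "c \<in> (\<lambda>a. poly f a mod m) ` {0..m - 1}"
      using assms(1) \<open>d \<le> m\<close>
      by (auto simp: permutation_poly_mod_def residue_ring_def bij_betw_def)
    then obtain a where "c = poly f a mod m" by blast
    then have "[poly f a = c] (mod d)"
      using assms(2) by (simp add: cong_def mod_mod_cancel)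
    then have "[poly f (a mod d) = c] (mod d)"
      using cong_poly[of "a mod d" a d f] by (auto intro: cong_trans)
    then have "?g (a mod d) = c"
      using c by (simp add: cong_def)
    then show "c \<in> ?g ` ?R"
      using assms(4) by (intro image_eqI[of _ _ "a mod d"]) (auto simp: zle_diff1_eq)
  qed
  with sub have "?g ` ?R = ?R" by blast
  then show ?thesis
    by (auto simp: permutation_poly_mod_def residue_ring_def bij_betw_def
        intro!: eq_card_imp_inj_on)
qed

text \<open>
  If $p$ divides $f'(a)$, then $a$ and $a + p^{t-1}$ have the same value modulo $p^t$, since
  $t > 1$ makes $p^{2(t-1)}$ a multiple of $p^t$. Conversely, let all $f'(a)$ be prime to $p$.
  If $p^{k+1}$ divides $f(b) - f(a)$ and $b - a = p^k c$ with $k \geq 1$, then $p$ divides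
  $c f'(a)$ and hence $c$; so a congruence between arguments modulo $p$ improves step by step to
  one modulo $p^t$.
\<close>
theorem permutation_poly_mod_prime_power_iff:
  fixes p :: int
  assumes p: "prime p" and t: "t > 1"
  shows "permutation_poly_mod (p ^ t) f \<longleftrightarrow>
    permutation_poly_mod p f \<and> (\<forall>a. \<not> p dvd poly (pderiv f) a)"
proof (intro iffI conjI allI)
  have p1: "p > 1" using p by (rule prime_gt_1_int)
  assume perm: "permutation_poly_mod (p ^ t) f"
  show "permutation_poly_mod p f"
    using perm by (rule permutation_poly_mod_dvd) (use p1 t in auto)
  fix a
  show "\<not> p dvd poly (pderiv f) a"
  proof
    assume "p dvd poly (pderiv f) a"
    then obtain c where c: "poly (pderiv f) a = p * c" by blast
    define h where "h = p ^ (t - 1)"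
    have ph: "p ^ t = h * p"
      using t by (simp add: h_def flip: power_Suc2)
    have "p dvd h"
      using t by (simp add: h_def)
    then obtain e where e: "h = p * e" by blast
    obtain q where "poly f (a + h) = poly f a + h * poly (pderiv f) a + h\<^sup>2 * q"
      using poly_add_second_order by blast
    then have "poly f (a + h) - poly f a = p ^ t * (c + e * q)"
      using e by (simp add: c ph algebra_simps power2_eq_square)
    then have "[poly f (a + h) = poly f a] (mod p ^ t)"
      by (simp add: cong_iff_dvd_diff)
    then have "[a + h = a] (mod p ^ t)"
      using perm p1 by (subst (asm) permutation_poly_mod_iff_inj) auto
    then have "p ^ t dvd p ^ (t - 1)"
      by (simp add: cong_iff_dvd_diff h_def)
    then have "p ^ t \<le> p ^ (t - 1)"
      using p1 by (intro zdvd_imp_le) auto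
    moreover have "p ^ (t - 1) < p ^ t"
      using p1 t by (intro power_strict_increasing) auto
    ultimately show False by simp
  qed
next
  have p1: "p > 1" using p by (rule prime_gt_1_int)
  assume *: "permutation_poly_mod p f \<and> (\<forall>a. \<not> p dvd poly (pderiv f) a)"
  have "p ^ Suc k dvd poly f b - poly f a \<Longrightarrow> p ^ Suc k dvd b - a" for k a b
  proof (induction k)
    case 0
    then show ?case
      using * p1 by (subst (asm) permutation_poly_mod_iff_inj) (auto simp: cong_iff_dvd_diff)
  next
    case (Suc k)
    have "p ^ Suc k dvd p ^ Suc (Suc k)"
      by (rule le_imp_power_dvd) simp
    then have "p ^ Suc k dvd b - a"
      using Suc by (blast intro: dvd_trans)
    then obtain c where c: "b - a = p ^ Suc k * c" by blast
    let ?h = "p ^ Suc k * c"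
    have b: "b = a + ?h" using c by simp
    obtain q where q: "poly f b = poly f a + ?h * poly (pderiv f) a + ?h\<^sup>2 * q"
      unfolding b using poly_add_second_order by blast
    have "?h\<^sup>2 * q = p ^ Suc (Suc k) * (p ^ k * c\<^sup>2 * q)"
      by (simp add: power2_eq_square algebra_simps)
    then have "p ^ Suc (Suc k) dvd ?h\<^sup>2 * q" by (simp only: dvd_triv_left)
    with Suc.prems have "p ^ Suc (Suc k) dvd ?h * poly (pderiv f) a"
      by (simp add: q dvd_add_left_iff)
    then have "p ^ Suc k * p dvd p ^ Suc k * (c * poly (pderiv f) a)"
      by (simp add: mult_ac)
    then have "p dvd c * poly (pderiv f) a"
      using p1 by (subst (asm) dvd_mult_cancel_left) auto
    then have "p dvd c"
      using * p by (auto simp: prime_dvd_mult_iff)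
    then show ?case
      by (auto simp: c mult_ac)
  qed
  from this[of "t - 1"] have lift: "p ^ t dvd b - a" if "p ^ t dvd poly f b - poly f a" for a b
    using t that by simp
  have pos: "p ^ t > 0" using p1 by simp
  show "permutation_poly_mod (p ^ t) f"
    unfolding permutation_poly_mod_iff_inj[OF pos] cong_iff_dvd_diff
    using lift by blast
qed

section \<open>The recurrence for reversed Dickson polynomials\<close>

lemma rev_dickson2_0 [simp]: "rev_dickson2 0 = 1"
  by (simp add: rev_dickson2_def)

lemma rev_dickson2_1 [simp]: "rev_dickson2 (Suc 0) = 1"
  by (simp add: rev_dickson2_def)

text \<open>
  Since the additional binomial coefficients vanish, sums for different $n$ can be given a common
  range, so that Pascal's rule can be applied term by term.
\<close>
lemma rev_dickson2_altdef:
  assumes "n \<le> N"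
  shows "rev_dickson2 n = (\<Sum>i\<le>N. of_nat ((n - i) choose i) * (- [:0, 1:]) ^ i)"
  unfolding rev_dickson2_def using assms
  by (intro sum.mono_neutral_left) (auto simp: binomial_eq_0)

lemma rev_dickson2_rec:
  "rev_dickson2 (Suc (Suc n)) = rev_dickson2 (Suc n) - [:0, 1:] * rev_dickson2 n"
proof -
  define x where "x = - ([:0, 1:] :: int poly)"
  note altdef = rev_dickson2_altdef[folded x_def]
  have pascal: "(Suc (Suc n) - Suc i) choose Suc i =
      ((Suc n - Suc i) choose Suc i) + ((n - i) choose i)"
    if "i \<le> n" for i
    using that by (simp add: Suc_diff_le)
  have "rev_dickson2 (Suc (Suc n)) = 
      (\<Sum>i\<le>Suc (Suc n). of_nat ((Suc (Suc n) - i) choose i) * x ^ i)"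
    by (rule altdef) simp
  also have "\<dots> = 1 + (\<Sum>i\<le>n. of_nat ((Suc (Suc n) - Suc i) choose Suc i) * x ^ Suc i)"
    by (subst sum.atMost_Suc, subst sum.atMost_Suc_shift) (simp del: power_Suc)
  also have "\<dots> = 1 + (\<Sum>i\<le>n. of_nat ((Suc n - Suc i) choose Suc i) * x ^ Suc i)
      + x * (\<Sum>i\<le>n. of_nat ((n - i) choose i) * x ^ i)"
  proof -
    have "(\<Sum>i\<le>n. of_nat ((Suc (Suc n) - Suc i) choose Suc i) * x ^ Suc i) =
        (\<Sum>i\<le>n. of_nat ((Suc n - Suc i) choose Suc i) * x ^ Suc i
          + x * (of_nat ((n - i) choose i) * x ^ i))"
      using pascal by (intro sum.cong) (simp_all add: algebra_simps del: diff_Suc_Suc)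
    then show ?thesis
      by (simp only: sum.distrib sum_distrib_left add.assoc)
  qed
  also have "(\<Sum>i\<le>n. of_nat ((n - i) choose i) * x ^ i) = rev_dickson2 n"
    by (rule altdef[symmetric]) simp
  also have "1 + (\<Sum>i\<le>n. of_nat ((Suc n - Suc i) choose Suc i) * x ^ Suc i) = rev_dickson2 (Suc n)"
    by (subst altdef[OF order_refl], subst sum.atMost_Suc_shift) simp
  finally show ?thesis by (simp add: x_def)
qed

section \<open>Values and derivatives modulo 3\<close>

text \<open>
  Two consecutive indices are recorded because the recurrence has order two; the values come along
  with the derivatives because $E_n(a)$ enters the recurrence for the derivative.
\<close>
definition value_residues :: "nat \<Rightarrow> int \<Rightarrow> int \<times> int \<times> int \<times> int" where
  "value_residues n a =
     (poly (rev_dickson2 n) a mod 3, poly (rev_dickson2 (Suc n)) a mod 3,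
      poly (pderiv (rev_dickson2 n)) a mod 3, poly (pderiv (rev_dickson2 (Suc n))) a mod 3)"

text \<open>
  The derivative of the recurrence is $E_{n+2}' = E_{n+1}' - E_n - x E_n'$.
\<close>
definition residue_step :: "int \<Rightarrow> int \<times> int \<times> int \<times> int \<Rightarrow> int \<times> int \<times> int \<times> int" where
  "residue_step a = (\<lambda>(u, v, u', v'). (v, (v - a * u) mod 3, v', (v' - u - a * u') mod 3))"

lemma residue_step_mod_3:
  "residue_step a (u mod 3, v mod 3, u' mod 3, v' mod 3) =
     (v mod 3, (v - a * u) mod 3, v' mod 3, (v' - u - a * u') mod 3)"
  by (auto simp: residue_step_def simp flip: cong_def intro!: cong_diff cong_mult)

lemma value_residues_0: "value_residues 0 a = (1, 1, 0, 0)"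
  by (simp add: value_residues_def)

lemma value_residues_Suc: "value_residues (Suc n) a = residue_step a (value_residues n a)"
  unfolding value_residues_def residue_step_mod_3 rev_dickson2_rec
  by (simp add: pderiv_diff pderiv_pCons diff_diff_eq)

type_synonym joint_residues =
  "(int \<times> int \<times> int \<times> int) \<times> (int \<times> int \<times> int \<times> int) \<times> (int \<times> int \<times> int \<times> int)"

definition joint_residues :: "nat \<Rightarrow> joint_residues" where
  "joint_residues n = (value_residues n 0, value_residues n 1, value_residues n 2)"

definition joint_step :: "joint_residues \<Rightarrow> joint_residues" where
  "joint_step = map_prod (residue_step 0) (map_prod (residue_step 1) (residue_step 2))"

text \<open>
  The criterion for prime powers, read off from the residues at $0$, $1$ and $2$: distinct values
  and nonzero derivatives.
\<close>
definition permuting :: "joint_residues \<Rightarrow> bool" where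
  "permuting = (\<lambda>((u\<^sub>0, _, d\<^sub>0, _), (u\<^sub>1, _, d\<^sub>1, _), (u\<^sub>2, _, d\<^sub>2, _)).
     distinct [u\<^sub>0, u\<^sub>1, u\<^sub>2] \<and> 0 \<notin> set [d\<^sub>0, d\<^sub>1, d\<^sub>2])"

lemma permutation_poly_mod_3_power_iff:
  assumes "t > 1"
  shows "permutation_poly_mod (3 ^ t) (rev_dickson2 n) \<longleftrightarrow> permuting (joint_residues n)"
proof -
  let ?E = "rev_dickson2 n"
  have mod_3: "a mod 3 \<in> {0, 1, 2}" for a :: int
    using pos_mod_bound[of 3 a] pos_mod_sign[of 3 a] by auto
  have R: "carrier (residue_ring 3) = {0, 1, 2}"
    by (auto simp: residue_ring_def)
  have "permutation_poly_mod 3 ?E \<longleftrightarrow> inj_on (\<lambda>a. poly ?E a mod 3) {0, 1, 2}"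
  proof -
    have "(\<lambda>a. poly ?E a mod 3) ` {0, 1, 2} \<subseteq> {0, 1, 2}"
      by (rule image_subsetI) (rule mod_3)
    then have "inj_on (\<lambda>a. poly ?E a mod 3) {0, 1, 2} \<Longrightarrow>
        (\<lambda>a. poly ?E a mod 3) ` {0, 1, 2} = {0, 1, 2}"
      by (intro endo_inj_surj) simp_all
    then show ?thesis
      unfolding permutation_poly_mod_def R bij_betw_def by blast
  qed
  moreover have "(\<forall>a. \<not> 3 dvd poly (pderiv ?E) a) \<longleftrightarrow>
      (\<forall>a\<in>{0, 1, 2}. \<not> 3 dvd poly (pderiv ?E) a)" (is "?L \<longleftrightarrow> ?R")
  proof
    assume ?R
    show ?L
    proof
      fix a :: int
      from mod_3 \<open>?R\<close> have "\<not> 3 dvd poly (pderiv ?E) (a mod 3)" by blast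
      moreover have "[poly (pderiv ?E) (a mod 3) = poly (pderiv ?E) a] (mod 3)"
        by (rule cong_poly) simp
      ultimately show "\<not> 3 dvd poly (pderiv ?E) a"
        by (simp add: cong_dvd_iff)
    qed
  qed blast
  moreover have "permuting (joint_residues n) \<longleftrightarrow>
      inj_on (\<lambda>a. poly ?E a mod 3) {0, 1, 2} \<and> (\<forall>a\<in>{0, 1, 2}. \<not> 3 dvd poly (pderiv ?E) a)"
  proof -
    have inj: "inj_on g {0, 1, 2} \<longleftrightarrow> distinct [g 0, g 1, g 2]" for g :: "int \<Rightarrow> int"
      by (auto simp: inj_on_def)
    have dvd: "3 dvd x \<longleftrightarrow> 0 = x mod 3" for x :: int
      by presburger
    show ?thesis
      unfolding permuting_def joint_residues_def value_residues_def inj dvd prod.case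
        list.set ball_simps Set.insert_iff by blast
  qed
  ultimately show ?thesis
    using assms permutation_poly_mod_prime_power_iff[of 3 t ?E] by simp
qed

section \<open>The period 72\<close>

lemma joint_residues_Suc_0:
  "joint_residues (Suc 0) = ((1, 1, 0, 2), (1, 0, 0, 2), (1, 2, 0, 2))"
  by (simp add: joint_residues_def value_residues_Suc value_residues_0 residue_step_def)

lemma joint_residues_Suc: "joint_residues (Suc n) = joint_step (joint_residues n)"
  by (simp add: joint_residues_def joint_step_def value_residues_Suc)

lemma joint_residues_funpow:
  "joint_residues (Suc k) = (joint_step ^^ k) (joint_residues (Suc 0))"
proof (induction k)
  case (Suc k)
  then show ?case
    unfolding joint_residues_Suc[of "Suc k"] funpow.simps comp_def by (rule arg_cong)
qed simp

text \<open>
  After 72 steps the orbit returns to its state at index 1 (not to the one at index 0, which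
  differs in the derivative at $0$).
\<close>
lemma joint_residues_period: "joint_residues (Suc k) = joint_residues (Suc (k mod 72))"
proof -
  let ?s = "((1, 1, 0, 2), (1, 0, 0, 2), (1, 2, 0, 2)) :: joint_residues"
  have "(joint_step ^^ 72) ?s = ?s"
    by code_simp
  then have "(joint_step ^^ (k mod 72)) ?s = (joint_step ^^ k) ?s"
    by (rule funpow_mod_eq)
  then show ?thesis
    by (simp add: joint_residues_funpow[of k] joint_residues_funpow[of "k mod 72"]
        joint_residues_Suc_0)
qed

text \<open>
  Evaluating \<open>orbit\<close> produces a whole period in one pass, each state from its predecessor,
  instead of iterating anew for each index.
\<close>
primrec orbit :: "('a \<Rightarrow> 'a) \<Rightarrow> 'a \<Rightarrow> nat \<Rightarrow> 'a list" where
  "orbit f x 0 = []"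
| "orbit f x (Suc n) = x # orbit f (f x) n"

lemma orbit_eq_map: "orbit f x n = map (\<lambda>k. (f ^^ k) x) [0..<n]"
proof (induction n arbitrary: x)
  case (Suc n)
  show ?case
    by (simp add: Suc map_upt_Suc funpow_swap1 del: upt_Suc)
qed simp

lemma permuting_table:
  assumes "k < 72"
  shows "permuting (joint_residues (Suc k)) \<longleftrightarrow>
    Suc k \<in> {2, 3, 5, 15, 20, 29, 39, 50, 51, 68}"
proof -
  let ?s = "((1, 1, 0, 2), (1, 0, 0, 2), (1, 2, 0, 2)) :: joint_residues"
  have "map permuting (orbit joint_step ?s 72) =
      map (\<lambda>k. Suc k \<in> {2, 3, 5, 15, 20, 29, 39, 50, 51, 68}) [0..<72]"
    by code_simp
  then have *: "\<forall>k\<in>set [0..<72]. permuting ((joint_step ^^ k) ?s) \<longleftrightarrow>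
      Suc k \<in> {2, 3, 5, 15, 20, 29, 39, 50, 51, 68}"
    unfolding orbit_eq_map map_map by (simp only: map_eq_conv comp_def)
  have "k \<in> set [0..<72]"
    using assms by simp
  with * show ?thesis
    unfolding joint_residues_funpow[of k] joint_residues_Suc_0 by (rule bspec)
qed

theorem theorem4p26:
  fixes t n :: nat
  assumes "t > 1"
  shows "permutation_poly_mod (3 ^ t) (rev_dickson2 n) \<longleftrightarrow>
    (\<exists>s\<in>{2, 3, 5, 15, 20, 29, 39, 50, 51, 68}. [n = s] (mod 72))"
proof (cases n)
  case 0
  have "\<not> permuting (joint_residues 0)"
    by (simp add: permuting_def joint_residues_def value_residues_0)
  then show ?thesis
    using permutation_poly_mod_3_power_iff[OF assms, of n] by (simp add: 0 cong_def)
next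
  case (Suc k)
  have "permutation_poly_mod (3 ^ t) (rev_dickson2 n) \<longleftrightarrow> permuting (joint_residues (Suc k))"
    unfolding Suc by (rule permutation_poly_mod_3_power_iff) fact
  also have "\<dots> \<longleftrightarrow> Suc (k mod 72) \<in> {2, 3, 5, 15, 20, 29, 39, 50, 51, 68}"
    unfolding joint_residues_period[of k] by (rule permuting_table) simp
  also have "\<dots> \<longleftrightarrow> (\<exists>s\<in>{2, 3, 5, 15, 20, 29, 39, 50, 51, 68}. [n = s] (mod 72))"
    unfolding Suc by (simp add: cong_def mod_Suc)
  finally show ?thesis .
qed

end
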